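(* Let $\mathfrak{g}$ be a finite-dimensional $\mathsf{Lie}$-nilpotent Leibniz algebra such that $\gamma_2^{\mathsf{Lie}}(\mathfrak{g}) \neq 0$. Then the Lie algebra $\mathsf{Der}_z^{\mathsf{Lie}}(\mathfrak{g})$ of $\mathsf{Lie}$-central derivations of $\mathfrak{g}$ is abelian if and only if $\mathfrak{g}$ is a $\mathsf{Lie}$-stem Leibniz algebra.
   Context: $\mathbb{K}$ is a fixed ground field with $\frac12\in\mathbb{K}$. A Leibniz algebra over $\mathbb{K}$ is a $\mathbb{K}$-vector space $\mathfrak{g}$ with a bilinear bracket satisfying $[x,[y,z]]=[[x,y],z]-[[x,z],y]$ for all $x,y,z$. Put $[x,y]_{lie}=[x,y]+[y,x]$. The $\mathsf{Lie}$-center is $Z_{\mathsf{Lie}}(\mathfrak{g})=\{z\in\mathfrak{g}\mid [g,z]_{lie}=0\ \text{for all } g\in\mathfrak{g}\}$. For two-sided ideals $\mathfrak{m},\mathfrak{n}$ of $\mathfrak{g}$, $[\mathfrak{m},\mathfrak{n}]_{\mathsf{Lie}}$ is the two-sided ideal generated by all $[m,n]_{lie}$, $m\in\mathfrak{m}$, $n\in\mathfrak{n}$. The lower $\mathsf{Lie}$-central series is $\gamma_1^{\mathsf{Lie}}(\mathfrak{g})=\mathfrak{g}$, $\gamma_i^{\mathsf{Lie}}(\mathfrak{g})=[\gamma_{i-1}^{\mathsf{Lie}}(\mathfrak{g}),\mathfrak{g}]_{\mathsf{Lie}}$ for $i\ge2$; in particular $\gamma_2^{\mathsf{Lie}}(\mathfrak{g})=[\mathfrak{g},\mathfrak{g}]_{\mathsf{Lie}}$.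 $\mathfrak{g}$ is $\mathsf{Lie}$-nilpotent of class $c$ if $\gamma_{c+1}^{\mathsf{Lie}}(\mathfrak{g})=0$ and $\gamma_c^{\mathsf{Lie}}(\mathfrak{g})\ne0$, and $\mathsf{Lie}$-nilpotent if this holds for some $c$. A $\mathsf{Lie}$-derivation of $\mathfrak{g}$ is a linear map $d:\mathfrak{g}\to\mathfrak{g}$ with $d([x,y]_{lie})=[d(x),y]_{lie}+[x,d(y)]_{lie}$ for all $x,y$; the set $\mathsf{Der}^{\mathsf{Lie}}(\mathfrak{g})$ of these is a Lie algebra under $[d_1,d_2]=d_1\circ d_2-d_2\circ d_1$. A $\mathsf{Lie}$-central derivation is a $\mathsf{Lie}$-derivation $d$ with $d(\mathfrak{g})\subseteq Z_{\mathsf{Lie}}(\mathfrak{g})$; these form the Lie subalgebra $\mathsf{Der}_z^{\mathsf{Lie}}(\mathfrak{g})$. $\mathfrak{g}$ is a $\mathsf{Lie}$-stem Leibniz algebra if $Z_{\mathsf{Lie}}(\mathfrak{g})\subseteq[\mathfrak{g},\mathfrak{g}]_{\mathsf{Lie}}$. *)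

theory Defs
  imports Complex_Main "HOL-Library.Function_Algebras"
begin

text \<open>
  Right Leibniz algebras; the underlying vector space is the whole type \<open>'g\<close>, over a field \<open>'k\<close>.
  No finiteness of dimension and no condition on the characteristic is built into the locale.
\<close>

locale leibniz_algebra = vector_space scale
  for scale :: "'k::field \<Rightarrow> 'g::ab_group_add \<Rightarrow> 'g" +
  fixes bracket :: "'g \<Rightarrow> 'g \<Rightarrow> 'g"
  assumes linear_left: "Vector_Spaces.linear scale scale (\<lambda>x. bracket x y)"
    and linear_right: "Vector_Spaces.linear scale scale (\<lambda>y. bracket x y)"
    and leibniz: "bracket x (bracket y z) = bracket (bracket x y) z - bracket (bracket x z) y"
begin

definition lie_bracket :: "'g \<Rightarrow> 'g \<Rightarrow> 'g" where
  "lie_bracket x y = bracket x y + bracket y x"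

definition lie_center :: "'g set" where
  "lie_center = {z. \<forall>g. lie_bracket g z = 0}"

definition two_sided_ideal :: "'g set \<Rightarrow> bool" where
  "two_sided_ideal I \<longleftrightarrow>
    subspace I \<and> (\<forall>x. \<forall>a\<in>I. bracket x a \<in> I \<and> bracket a x \<in> I)"

definition lie_commutator :: "'g set \<Rightarrow> 'g set \<Rightarrow> 'g set" where
  "lie_commutator M N = two_sided_ideal hull {lie_bracket m n | m n. m \<in> M \<and> n \<in> N}"

text \<open>The series starts at index 1; the value at 0 is a dummy.\<close>

fun lie_lower_central :: "nat \<Rightarrow> 'g set" where
  "lie_lower_central 0 = UNIV"
| "lie_lower_central (Suc 0) = UNIV"
| "lie_lower_central (Suc (Suc i)) = lie_commutator (lie_lower_central (Suc i)) UNIV"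

definition lie_nilpotent_of_class :: "nat \<Rightarrow> bool" where
  "lie_nilpotent_of_class c \<longleftrightarrow>
    c \<ge> 1 \<and> lie_lower_central (c + 1) = {0} \<and> lie_lower_central c \<noteq> {0}"

definition lie_nilpotent :: bool where
  "lie_nilpotent \<longleftrightarrow> (\<exists>c. lie_nilpotent_of_class c)"

definition lie_stem :: bool where
  "lie_stem \<longleftrightarrow> lie_center \<subseteq> lie_commutator UNIV UNIV"

definition lie_derivations :: "('g \<Rightarrow> 'g) set" where
  "lie_derivations = {d. Vector_Spaces.linear scale scale d \<and>
    (\<forall>x y. d (lie_bracket x y) = lie_bracket (d x) y + lie_bracket x (d y))}"

definition lie_central_derivations :: "('g \<Rightarrow> 'g) set" where
  "lie_central_derivations = {d \<in> lie_derivations. range d \<subseteq> lie_center}"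

end

text \<open>The zero map and the difference of maps are the pointwise ones of \<^theory>\<open>HOL-Library.Function_Algebras\<close>.\<close>

definition endo_bracket :: "('a \<Rightarrow> 'a) \<Rightarrow> ('a \<Rightarrow> 'a) \<Rightarrow> 'a \<Rightarrow> 'a::ab_group_add" where
  "endo_bracket d1 d2 = (d1 \<circ> d2) - (d2 \<circ> d1)"

definition abelian_on :: "'a set \<Rightarrow> ('a \<Rightarrow> 'a \<Rightarrow> 'a::zero) \<Rightarrow> bool" where
  "abelian_on L b \<longleftrightarrow> (\<forall>x\<in>L. \<forall>y\<in>L. b x y = 0)"

text \<open>
  Both sets of derivations are Lie algebras under \<^const>\<open>endo_bracket\<close>: they are closed under
  the operations below, and the bracket is alternating and satisfies the Jacobi identity on
  additive maps.
\<close>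

lemma endo_bracket_self: "endo_bracket d d = 0"
  by (simp add: endo_bracket_def)

lemma endo_bracket_Jacobi:
  assumes "\<And>x y. d1 (x - y) = d1 x - d1 y" "\<And>x y. d2 (x - y) = d2 x - d2 y"
    "\<And>x y. d3 (x - y) = d3 x - d3 y"
  shows "endo_bracket d1 (endo_bracket d2 d3) + endo_bracket d2 (endo_bracket d3 d1)
    + endo_bracket d3 (endo_bracket d1 d2) = 0"
  by (rule ext) (simp add: endo_bracket_def assms fun_diff_def)

context leibniz_algebra
begin

lemma lie_bracket_linear:
  "lie_bracket (x + y) z = lie_bracket x z + lie_bracket y z"
  "lie_bracket z (x + y) = lie_bracket z x + lie_bracket z y"
  "lie_bracket (x - y) z = lie_bracket x z - lie_bracket y z"
  "lie_bracket z (x - y) = lie_bracket z x - lie_bracket z y"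
  "lie_bracket (scale c x) z = scale c (lie_bracket x z)"
  "lie_bracket z (scale c x) = scale c (lie_bracket z x)"
proof -
  interpret L: Vector_Spaces.linear scale scale "\<lambda>x. bracket x z" by (rule linear_left)
  interpret R: Vector_Spaces.linear scale scale "\<lambda>y. bracket z y" by (rule linear_right)
  show "lie_bracket (x + y) z = lie_bracket x z + lie_bracket y z"
    "lie_bracket z (x + y) = lie_bracket z x + lie_bracket z y"
    "lie_bracket (x - y) z = lie_bracket x z - lie_bracket y z"
    "lie_bracket z (x - y) = lie_bracket z x - lie_bracket z y"
    "lie_bracket (scale c x) z = scale c (lie_bracket x z)"
    "lie_bracket z (scale c x) = scale c (lie_bracket z x)"
    by (simp_all add: lie_bracket_def L.add L.diff L.scale R.add R.diff R.scale
        scale_right_distrib algebra_simps)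
qed

lemma subspace_lie_center: "subspace lie_center"
  by (rule subspaceI) (use lie_bracket_linear(4)[of _ 0 0] in
    \<open>auto simp: lie_center_def lie_bracket_linear\<close>)

lemma lie_derivations_closed:
  assumes "d1 \<in> lie_derivations" "d2 \<in> lie_derivations"
  shows "0 \<in> lie_derivations" "d1 + d2 \<in> lie_derivations"
    "(\<lambda>x. scale c (d1 x)) \<in> lie_derivations" "endo_bracket d1 d2 \<in> lie_derivations"
proof -
  interpret d1: Vector_Spaces.linear scale scale d1
    using assms(1) by (simp add: lie_derivations_def)
  interpret d2: Vector_Spaces.linear scale scale d2
    using assms(2) by (simp add: lie_derivations_def)
  have der: "d1 (lie_bracket x y) = lie_bracket (d1 x) y + lie_bracket x (d1 y)"
    "d2 (lie_bracket x y) = lie_bracket (d2 x) y + lie_bracket x (d2 y)" for x y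
    using assms by (simp_all add: lie_derivations_def)
  have zero: "lie_bracket 0 x = 0" "lie_bracket x 0 = 0" for x
    using lie_bracket_linear(3)[of 0 0 x] lie_bracket_linear(4)[of x 0 0] by simp_all
  have lin: "Vector_Spaces.linear scale scale f"
    if "\<And>x y. f (x + y) = f x + f y" "\<And>a x. f (scale a x) = scale a (f x)" for f
    using that by unfold_locales auto
  show "0 \<in> lie_derivations"
    by (auto simp: lie_derivations_def zero zero_fun_def intro!: lin)
  show "d1 + d2 \<in> lie_derivations"
    by (auto simp: lie_derivations_def der lie_bracket_linear d1.add d2.add d1.scale d2.scale
        scale_right_distrib algebra_simps intro!: lin)
  show "(\<lambda>x. scale c (d1 x)) \<in> lie_derivations"
    by (auto simp: lie_derivations_def der lie_bracket_linear d1.add d1.scale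
        scale_right_distrib scale_left_commute intro!: lin)
  show "endo_bracket d1 d2 \<in> lie_derivations"
    by (auto simp: lie_derivations_def endo_bracket_def fun_diff_def der lie_bracket_linear
        d1.add d2.add d1.scale d2.scale scale_right_diff_distrib algebra_simps intro!: lin)
qed

lemma lie_central_derivations_closed:
  assumes "d1 \<in> lie_central_derivations" "d2 \<in> lie_central_derivations"
  shows "0 \<in> lie_central_derivations" "d1 + d2 \<in> lie_central_derivations"
    "(\<lambda>x. scale c (d1 x)) \<in> lie_central_derivations"
    "endo_bracket d1 d2 \<in> lie_central_derivations"
proof -
  have d: "d1 \<in> lie_derivations" "d2 \<in> lie_derivations"
    and z: "\<And>x. d1 x \<in> lie_center" "\<And>x. d2 x \<in> lie_center"
    using assms by (auto simp: lie_central_derivations_def)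
  show "0 \<in> lie_central_derivations" "d1 + d2 \<in> lie_central_derivations"
    "(\<lambda>x. scale c (d1 x)) \<in> lie_central_derivations"
    "endo_bracket d1 d2 \<in> lie_central_derivations"
    using lie_derivations_closed[OF d] z subspace_lie_center
    by (auto simp: lie_central_derivations_def endo_bracket_def fun_diff_def
        intro: subspace_0 subspace_add subspace_scale subspace_diff)
qed

end

end

theory Submission
  imports Defs
begin

text \<open>
  The span of the brackets \<open>[x, y]\<^sub>l\<^sub>i\<^sub>e\<close> is already a two-sided ideal: left multiplication annihilates it
  and right multiplication is a derivation. So a \<open>Lie\<close>-central derivation is exactly a linear map
  into the \<open>Lie\<close>-center \<open>Z\<close> that vanishes on \<open>\<gamma>\<^sub>2\<close>, and any two of them compose to zero when
  \<open>Z \<subseteq> \<gamma>\<^sub>2\<close>. Conversely, let \<open>z \<in> Z - \<gamma>\<^sub>2\<close>. The last nonzero term of the lower series is contained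
  in \<open>Z \<inter> \<gamma>\<^sub>2\<close>; pick \<open>w \<noteq> 0\<close> in it. Rank-one maps killing \<open>\<gamma>\<^sub>2\<close> and sending \<open>z\<close> to \<open>z\<close> and to \<open>w\<close>,
  respectively, do not commute.
\<close>

text \<open>Since \<open>z\<close> lies outside \<open>U\<close>, adjoining it to a basis
  \<open>B\<close> of \<open>U\<close> keeps independence. Prescribing 0 on \<open>B\<close> and
  \<open>v\<close> at \<open>z\<close> then extends linearly, with range spanned by the prescribed
  values.\<close>

lemma (in vector_space) exists_rank_one_map:
  assumes "subspace U" and "z \<notin> U"
  shows "\<exists>d. Vector_Spaces.linear scale scale d \<and> (\<forall>u\<in>U. d u = 0) \<and> d z = v
    \<and> range d \<subseteq> span {v}"
proof -
  interpret P: vector_space_pair scale scale ..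
  obtain B where B: "B \<subseteq> U" "independent B" "U \<subseteq> span B"
    using maximal_independent_subset[of U] by blast
  have "span B \<subseteq> U"
    using B(1) assms(1) by (simp add: span_minimal)
  with assms(2) have z: "z \<notin> span B"
    by blast
  with B(2) have ind: "independent (insert z B)"
    by (simp add: independent_insertI)
  let ?f = "\<lambda>x. if x = z then v else 0"
  obtain d where d: "Vector_Spaces.linear scale scale d" "\<forall>x\<in>insert z B. d x = ?f x"
    and ran: "range d = span (?f ` insert z B)"
    using P.linear_independent_extend_subspace[OF ind, of ?f] by metis
  interpret d: Vector_Spaces.linear scale scale d
    by (rule d(1))
  have "d b = 0" if "b \<in> B" for b
    using d(2) that z span_base[of b B] by auto
  then have "d u = 0" if "u \<in> U" for u
    using P.linear_eq_0_on_span[OF d(1)] B(3) that by blast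
  moreover have "range d \<subseteq> span {v}"
    unfolding ran by (rule span_minimal) (auto simp: span_base span_zero)
  ultimately show ?thesis
    using d by auto
qed

context leibniz_algebra
begin

lemma bracket_add:
  "bracket (x + y) z = bracket x z + bracket y z"
  "bracket z (x + y) = bracket z x + bracket z y"
proof -
  interpret L: Vector_Spaces.linear scale scale "\<lambda>x. bracket x z" by (rule linear_left)
  interpret R: Vector_Spaces.linear scale scale "\<lambda>y. bracket z y" by (rule linear_right)
  show "bracket (x + y) z = bracket x z + bracket y z"
    "bracket z (x + y) = bracket z x + bracket z y"
    by (rule L.add R.add)+
qed

text \<open>The right-hand side of the Leibniz identity is antisymmetric in \<open>y\<close> and
  \<open>z\<close>, so symmetrising cancels it.\<close>

lemma bracket_lie_bracket: "bracket x (lie_bracket y z) = 0"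
  by (simp add: lie_bracket_def bracket_add leibniz)

text \<open>Rearranged, the Leibniz identity says that right multiplication by \<open>x\<close> is a
  derivation of \<open>bracket\<close>, hence also of its symmetrisation.\<close>

lemma lie_bracket_bracket:
  "bracket (lie_bracket y z) x = lie_bracket (bracket y x) z + lie_bracket y (bracket z x)"
  by (simp add: lie_bracket_def bracket_add leibniz)

lemma lie_bracket_mem_lie_commutator:
  assumes "m \<in> M" "n \<in> N"
  shows "lie_bracket m n \<in> lie_commutator M N"
  using hull_subset[of "{lie_bracket m n | m n. m \<in> M \<and> n \<in> N}" two_sided_ideal] assms
  unfolding lie_commutator_def by blast

lemma lie_commutator_mono:
  assumes "M \<subseteq> M'" "N \<subseteq> N'"
  shows "lie_commutator M N \<subseteq> lie_commutator M' N'"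
  unfolding lie_commutator_def by (rule hull_mono) (use assms in blast)

lemma two_sided_ideal_span_lie_brackets:
  "two_sided_ideal (span {lie_bracket x y | x y. True})" (is "two_sided_ideal (span ?S)")
proof -
  have "bracket x a \<in> span ?S \<and> bracket a x \<in> span ?S" if a: "a \<in> span ?S" for x a
  proof -
    interpret L: Vector_Spaces.linear scale scale "\<lambda>y. bracket x y" by (rule linear_right)
    interpret R: Vector_Spaces.linear scale scale "\<lambda>y. bracket y x" by (rule linear_left)
    \<comment> \<open>A linear map sends a span to the span of the images, so both inclusions need
      checking only on generators.\<close>
    have "bracket x ` span ?S \<subseteq> span ?S"
      unfolding L.span_image[symmetric]
      by (rule span_minimal) (auto simp: bracket_lie_bracket span_zero)
    moreover have "(\<lambda>y. bracket y x) ` span ?S \<subseteq> span ?S"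
      unfolding R.span_image[symmetric]
      by (rule span_minimal) (force simp: lie_bracket_bracket intro!: span_add intro: span_base)+
    ultimately show ?thesis
      using a by blast
  qed
  then show ?thesis
    by (simp add: two_sided_ideal_def)
qed

text \<open>This replaces ideal generation by linear generation, so that a linear map killing all
  Lie brackets kills \<open>\<gamma>\<^sub>2\<close>.\<close>

lemma lie_commutator_UNIV: "lie_commutator UNIV UNIV = span {lie_bracket x y | x y. True}"
proof
  show "lie_commutator UNIV UNIV \<subseteq> span {lie_bracket x y | x y. True}"
    unfolding lie_commutator_def
    by (rule hull_minimal) (auto simp: two_sided_ideal_span_lie_brackets[simplified] intro: span_base)
  have "subspace (lie_commutator UNIV UNIV)"
    unfolding lie_commutator_def hull_def two_sided_ideal_def
    by (rule subspace_Inter) auto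
  then show "span {lie_bracket x y | x y. True} \<subseteq> lie_commutator UNIV UNIV"
    by (intro span_minimal) (auto intro: lie_bracket_mem_lie_commutator)
qed

lemma lie_bracket_commute: "lie_bracket x y = lie_bracket y x"
  by (simp add: lie_bracket_def add.commute)

text \<open>When the range is central, both terms on the right of the derivation rule vanish, and
  the rule only asks that \<open>d\<close> kill the generators of
  \<open>\<gamma>\<^sub>2\<close>.\<close>

lemma lie_central_derivations_iff:
  "d \<in> lie_central_derivations \<longleftrightarrow> Vector_Spaces.linear scale scale d
    \<and> range d \<subseteq> lie_center \<and> (\<forall>x\<in>lie_commutator UNIV UNIV. d x = 0)"
proof -
  interpret P: vector_space_pair scale scale ..
  have central: "lie_bracket (d x) y + lie_bracket x (d y) = 0" if "range d \<subseteq> lie_center" for x y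
  proof -
    have "lie_bracket y (d x) = 0" "lie_bracket x (d y) = 0"
      using that by (auto simp: lie_center_def)
    then show ?thesis
      by (simp add: lie_bracket_commute[of "d x"])
  qed
  have "(\<forall>x\<in>lie_commutator UNIV UNIV. d x = 0) \<longleftrightarrow> (\<forall>x y. d (lie_bracket x y) = 0)"
    if "Vector_Spaces.linear scale scale d"
    using P.linear_eq_0_on_span[OF that, of "{lie_bracket x y | x y. True}"]
      lie_bracket_mem_lie_commutator[of _ UNIV _ UNIV]
    unfolding lie_commutator_UNIV by blast
  with central show ?thesis
    by (auto simp: lie_central_derivations_def lie_derivations_def)
qed

lemma exists_nonzero_lie_center_commutator:
  assumes "lie_nilpotent" and "lie_lower_central 2 \<noteq> {0}"
  obtains w where "w \<in> lie_center" "w \<in> lie_commutator UNIV UNIV" "w \<noteq> 0"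
proof -
  obtain c where c: "c \<ge> 1" "lie_lower_central (c + 1) = {0}" "lie_lower_central c \<noteq> {0}"
    using assms(1) by (auto simp: lie_nilpotent_def lie_nilpotent_of_class_def)
  \<comment> \<open>Class 1 would force \<open>\<gamma>\<^sub>2\<close> to be zero. With class at
    least 2, the last nonzero term is itself a commutator and so lies in
    \<open>\<gamma>\<^sub>2\<close>.\<close>
  have "c \<noteq> 1"
    using c(2) assms(2) by (metis one_add_one)
  with c(1) obtain k where k: "c = Suc (Suc k)"
    by (cases c rule: lie_lower_central.cases) auto
  have sub: "lie_lower_central c \<subseteq> lie_commutator UNIV UNIV"
    by (simp add: k lie_commutator_mono)
  \<comment> \<open>This rules out the empty set, so differing from \<open>{0}\<close> yields a
    nonzero element.\<close>
  have "0 \<in> lie_lower_central c"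
    unfolding k lie_lower_central.simps lie_commutator_def hull_def two_sided_ideal_def
    by (simp add: subspace_0)
  then obtain w where w: "w \<in> lie_lower_central c" "w \<noteq> 0"
    using c(3) by blast
  have "lie_commutator (lie_lower_central c) UNIV = {0}"
    using c(2) by (simp add: k)
  \<comment> \<open>These brackets fall into the next term of the series, which is zero.\<close>
  then have "lie_bracket g w = 0" for g
    using lie_bracket_mem_lie_commutator[OF w(1), of g UNIV] by (simp add: lie_bracket_commute[of g])
  then have "w \<in> lie_center"
    unfolding lie_center_def by (intro CollectI allI)
  moreover have "w \<in> lie_commutator UNIV UNIV"
    using w(1) sub by (rule subsetD[rotated])
  ultimately show thesis
    using w(2) by (rule that)
qed

lemma abelian_lie_central_derivations_iff_lie_stem:
  assumes "lie_nilpotent" and "lie_lower_central 2 \<noteq> {0}"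
  shows "abelian_on lie_central_derivations endo_bracket \<longleftrightarrow> lie_stem"
proof
  assume stem: "lie_stem"
  have zero: "d1 (d2 x) = 0" if "d1 \<in> lie_central_derivations" "d2 \<in> lie_central_derivations"
    for d1 d2 x
    using that stem unfolding lie_central_derivations_iff lie_stem_def by blast
  then show "abelian_on lie_central_derivations endo_bracket"
    by (simp add: abelian_on_def endo_bracket_def fun_eq_iff zero)
next
  assume ab: "abelian_on lie_central_derivations endo_bracket"
  let ?C = "lie_commutator UNIV UNIV"
  show "lie_stem"
    unfolding lie_stem_def
  proof (rule subsetI, rule ccontr)
    fix z assume z: "z \<in> lie_center" "z \<notin> ?C"
    obtain w where w: "w \<in> lie_center" "w \<in> ?C" "w \<noteq> 0"
      using exists_nonzero_lie_center_commutator[OF assms] by blast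
    \<comment> \<open>Because \<open>z\<close> avoids \<open>\<gamma>\<^sub>2\<close>, its value
      under a central derivation may be any central element.\<close>
    have ex: "\<exists>d\<in>lie_central_derivations. d z = v" if "v \<in> lie_center" for v
    proof -
      have "subspace ?C"
        by (simp add: lie_commutator_UNIV)
      then obtain d where d: "Vector_Spaces.linear scale scale d" "\<forall>u\<in>?C. d u = 0" "d z = v"
        "range d \<subseteq> span {v}"
        using exists_rank_one_map[OF _ z(2)] by blast
      have "span {v} \<subseteq> lie_center"
        using that subspace_lie_center by (simp add: span_minimal)
      with d have "d \<in> lie_central_derivations"
        unfolding lie_central_derivations_iff by (intro conjI order_trans[OF d(4)])
      with d(3) show ?thesis
        by (rule bexI[where x = d])
    qed
    obtain d1 d2 where d: "d1 \<in> lie_central_derivations" "d1 z = z"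
      "d2 \<in> lie_central_derivations" "d2 z = w"
      using ex[OF z(1)] ex[OF w(1)] by blast
    \<comment> \<open>Directly, the commutator at \<open>z\<close> is \<open>d1 w - d2 z\<close>,
      which equals \<open>- w\<close> since \<open>d1\<close> kills
      \<open>\<gamma>\<^sub>2\<close>.\<close>
    have "endo_bracket d1 d2 z = 0"
      using ab d by (simp add: abelian_on_def)
    moreover have "d1 w = 0"
      using d(1) w(2) by (simp add: lie_central_derivations_iff)
    ultimately show False
      using d w(3) by (simp add: endo_bracket_def)
  qed
qed

end

theorem proposition3p2:
  fixes scale :: "'k::field \<Rightarrow> 'g::ab_group_add \<Rightarrow> 'g"
    and bracket :: "'g \<Rightarrow> 'g \<Rightarrow> 'g"
  assumes half: "(2::'k) \<noteq> 0"
    and leibniz: "leibniz_algebra scale bracket"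
    and fin_dim: "\<exists>B. finite_dimensional_vector_space scale B"
    and nilpotent: "leibniz_algebra.lie_nilpotent scale bracket"
    and gamma2: "leibniz_algebra.lie_lower_central scale bracket 2 \<noteq> {0}"
  shows "abelian_on (leibniz_algebra.lie_central_derivations scale bracket) endo_bracket
    \<longleftrightarrow> leibniz_algebra.lie_stem scale bracket"
  by (rule leibniz_algebra.abelian_lie_central_derivations_iff_lie_stem[OF leibniz nilpotent gamma2])

end
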